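(* Define graphs $G_n$ for all integers $n\ge 7$, each with vertices labeled $v_1,\dots,v_n$, as follows. $G_7$ has vertex set $\{v_1,\dots,v_7\}$ and the 15 edges $v_1v_2, v_1v_3, v_1v_4, v_1v_5, v_1v_6, v_1v_7, v_2v_3, v_2v_4, v_2v_5, v_2v_6, v_3v_4, v_3v_6, v_3v_7, v_4v_5, v_5v_7$. Suppose $G_n$ has been defined for some odd $n\ge 7$, with its vertices labeled so that $\mathrm{Tri}_{G_n}(v_1)>\mathrm{Tri}_{G_n}(v_2)>\cdots>\mathrm{Tri}_{G_n}(v_n)$. Let $k$ be the smallest index $1\le k\le n$ such that $d_{G_n}(v_k)$ equals the minimum degree of $G_n$. Then $G_{n+1}$ is obtained from $G_n$ by adding a new vertex $v_{n+1}$ and the single edge $v_kv_{n+1}$. Next, $G_{n+2}$ is obtained from $G_{n+1}$ by relabeling each vertex $v_i$ as $v_{i+1}$ ($1\le i\le n+1$), then adding a new vertex $v_1$ together with the edges $v_1v_i$ for all $2\le i\le n+2$ (i.e. $v_1$ is adjacent to every other vertex). Then for each $n\ge 7$, $G_n$ is triangle-distinct, with \[\mathrm{Tri}_{G_n}(v_1)>\mathrm{Tri}_{G_n}(v_2)>\cdots>\mathrm{Tri}_{G_n}(v_n),\] and moreover $d_{G_n}(v_1)\ge d_{G_n}(v_2)\ge\cdots\ge d_{G_n}(v_n)$. If $n$ is odd, then in addition $\mathrm{Tri}_{G_n}(v_n)>0$, $d_{G_n}(v_n)>0$, $e(G_n)=\mathrm{Tri}_{G_n}(v_1)+d_{G_n}(v_1)$,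 and $G_n$ is not regular.
   Context: All graphs are finite and simple. For a graph $G$ and vertex $v$, $d_G(v)$ is the degree of $v$, $e(G)$ is the number of edges, and $\mathrm{Tri}_G(v)$ (the triangle-degree of $v$) is the number of triangles of $G$ containing $v$, equivalently the number of edges with both endpoints in the neighborhood of $v$. A graph is triangle-distinct if it has at least two vertices and the triangle-degrees of its vertices are pairwise distinct. *)

theory Defs
  imports Main
begin

datatype 'a graph = Graph (verts: "'a set") (edges: "'a set set")

definition simple_graph :: "'a graph \<Rightarrow> bool" where
  "simple_graph H \<longleftrightarrow> finite (verts H) \<and> (\<forall>e\<in>edges H. e \<subseteq> verts H \<and> card e = 2)"

definition degree :: "'a graph \<Rightarrow> 'a \<Rightarrow> nat" where
  "degree H v = card {e \<in> edges H. v \<in> e}"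

definition min_degree :: "'a graph \<Rightarrow> nat" where
  "min_degree H = Min (degree H ` verts H)"

definition triangles :: "'a graph \<Rightarrow> 'a set set" where
  "triangles H = {T. T \<subseteq> verts H \<and> card T = 3 \<and> (\<forall>x\<in>T. \<forall>y\<in>T. x \<noteq> y \<longrightarrow> {x, y} \<in> edges H)}"

definition tri_degree :: "'a graph \<Rightarrow> 'a \<Rightarrow> nat" where
  "tri_degree H v = card {T \<in> triangles H. v \<in> T}"

definition triangle_distinct :: "'a graph \<Rightarrow> bool" where
  "triangle_distinct H \<longleftrightarrow>
     simple_graph H \<and> 2 \<le> card (verts H) \<and> inj_on (tri_degree H) (verts H)"

definition regular :: "'a graph \<Rightarrow> bool" where
  "regular H \<longleftrightarrow> (\<exists>d. \<forall>v\<in>verts H. degree H v = d)"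

text \<open>The vertex \<open>v\<^sub>i\<close> is the natural number \<open>i\<close>, so the graph on \<open>v\<^sub>1, \<dots>, v\<^sub>n\<close> has
  vertex set \<open>{1..n}\<close> and the relabelling \<open>v\<^sub>i \<mapsto> v\<^sub>i\<^sub>+\<^sub>1\<close> is \<open>Suc\<close>.\<close>

definition G7 :: "nat graph" where
  "G7 = Graph {1..7}
     {{1,2}, {1,3}, {1,4}, {1,5}, {1,6}, {1,7}, {2,3}, {2,4}, {2,5}, {2,6},
      {3,4}, {3,6}, {3,7}, {4,5}, {5,7}}"

definition first_min_degree :: "nat \<Rightarrow> nat graph \<Rightarrow> nat" where
  "first_min_degree n H = (LEAST k. 1 \<le> k \<and> k \<le> n \<and> degree H k = min_degree H)"

definition add_pendant :: "nat \<Rightarrow> nat graph \<Rightarrow> nat graph" where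
  "add_pendant n H =
     Graph (insert (n + 1) (verts H)) (insert {first_min_degree n H, n + 1} (edges H))"

definition relabel :: "nat graph \<Rightarrow> nat graph" where
  "relabel H = Graph (Suc ` verts H) ((`) Suc ` edges H)"

definition add_dominating :: "nat \<Rightarrow> nat graph \<Rightarrow> nat graph" where
  "add_dominating n H =
     Graph (insert 1 (verts (relabel H))) (edges (relabel H) \<union> {{1, i} | i. 2 \<le> i \<and> i \<le> n + 1})"

text \<open>Only the values for \<open>n \<ge> 7\<close> are meaningful.\<close>

fun Gseq :: "nat \<Rightarrow> nat graph" where
  "Gseq 0 = G7"
| "Gseq (Suc n) =
     (if n < 7 then G7
      else if odd n then add_pendant n (Gseq n)
      else add_dominating n (Gseq n))"

lemma first_min_degree:
  assumes "verts H = {1..n}" and "1 \<le> n"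
  shows "first_min_degree n H \<in> {1..n}"
    and "degree H (first_min_degree n H) = min_degree H"
proof -
  have "min_degree H \<in> degree H ` verts H"
    unfolding min_degree_def by (rule Min_in) (use assms in auto)
  then have "\<exists>k. 1 \<le> k \<and> k \<le> n \<and> degree H k = min_degree H"
    using assms by auto
  from LeastI_ex[OF this]
  show "first_min_degree n H \<in> {1..n}" "degree H (first_min_degree n H) = min_degree H"
    unfolding first_min_degree_def by auto
qed

lemma G7_simple: "simple_graph G7 \<and> verts G7 = {1..7}"
  by (simp add: simple_graph_def G7_def)

lemma add_pendant_simple:
  assumes "simple_graph H" "verts H = {1..n}" "1 \<le> n"
  shows "simple_graph (add_pendant n H) \<and> verts (add_pendant n H) = {1..Suc n}"
  using assms first_min_degree(1)[OF assms(2,3)]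
  by (fastforce simp: simple_graph_def add_pendant_def card_insert_if)

lemma add_dominating_simple:
  assumes "simple_graph H" "verts H = {1..n}"
  shows "simple_graph (add_dominating n H) \<and> verts (add_dominating n H) = {1..Suc n}"
proof -
  have V: "verts (add_dominating n H) = {1..Suc n}"
    using assms by (auto simp: add_dominating_def relabel_def)
  have "e \<subseteq> {1..Suc n} \<and> card e = 2" if "e \<in> edges (add_dominating n H)" for e
  proof -
    from that consider f where "f \<in> edges H" "e = Suc ` f"
      | i where "e = {1, i}" "2 \<le> i" "i \<le> n + 1"
      by (auto simp: add_dominating_def relabel_def)
    then show ?thesis
    proof cases
      case 1
      then have "f \<subseteq> {1..n}" "card f = 2"
        using assms by (auto simp: simple_graph_def)
      then show ?thesis
        using 1 by (auto simp: card_image)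
    next
      case 2
      then show ?thesis by auto
    qed
  qed
  with V show ?thesis by (simp add: simple_graph_def)
qed

lemma Gseq_simple:
  assumes "7 \<le> n"
  shows "simple_graph (Gseq n) \<and> verts (Gseq n) = {1..n}"
  using assms
proof (induction n rule: dec_induct)
  case base
  have "Gseq 7 = G7" by (simp add: eval_nat_numeral)
  then show ?case using G7_simple by simp
next
  case (step n)
  then show ?case
    using add_pendant_simple[of "Gseq n" n] add_dominating_simple[of "Gseq n" n] by auto
qed

end

theory Submission
  imports Defs
begin

text \<open>
  Adding a pendant vertex at the first vertex \<open>v\<^sub>k\<close> of minimum degree changes no triangle-degree and
  keeps the degrees ordered; since the graph is not regular, \<open>k \<noteq> 1\<close>, so
  \<open>Tri(v\<^sub>1) + d(v\<^sub>1)\<close> keeps the value \<open>e\<close> while the number of edges grows to \<open>e + 1\<close>.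
  Adding a dominating vertex \<open>w\<close> then replaces \<open>Tri(v)\<close> by \<open>Tri(v) + d(v)\<close> and gives
  \<open>Tri(w) = e + 1\<close>, which is larger than \<open>Tri(v\<^sub>1) + d(v\<^sub>1) = e\<close>.
\<close>

section \<open>Degrees and triangle-degrees\<close>

lemma simple_graph_edgeD:
  assumes "simple_graph H" "{x, y} \<in> edges H"
  shows "x \<in> verts H" "y \<in> verts H" "x \<noteq> y"
  using assms by (force simp: simple_graph_def)+

lemma simple_graph_edgeE:
  assumes "simple_graph H" "e \<in> edges H"
  obtains x y where "e = {x, y}" "x \<noteq> y" "x \<in> verts H" "y \<in> verts H"
proof -
  from assms have "card e = 2" "e \<subseteq> verts H"
    by (auto simp: simple_graph_def)
  with that show thesis
    by (auto simp: card_2_iff)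
qed

lemma simple_graph_finite_edges:
  assumes "simple_graph H"
  shows "finite (edges H)"
  using assms by (auto simp: simple_graph_def intro: finite_subset[of _ "Pow (verts H)"])

lemma edges_at_eq_image:
  assumes "simple_graph H"
  shows "{e \<in> edges H. v \<in> e} = (\<lambda>x. {v, x}) ` {x. {v, x} \<in> edges H}"
proof (intro equalityI subsetI)
  fix e assume "e \<in> {e \<in> edges H. v \<in> e}"
  then have e: "e \<in> edges H" "v \<in> e"
    by auto
  from e(1) obtain x y where "e = {x, y}"
    by (rule simple_graph_edgeE[OF assms])
  with e(2) obtain z where "e = {v, z}"
    by auto
  with e(1) show "e \<in> (\<lambda>x. {v, x}) ` {x. {v, x} \<in> edges H}"
    by auto
qed auto

lemma degree_eq_card_neighbours:
  assumes "simple_graph H"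
  shows "degree H v = card {x. {v, x} \<in> edges H}"
  unfolding degree_def edges_at_eq_image[OF assms]
  by (rule card_image) (auto simp: inj_on_def doubleton_eq_iff)

text \<open>No vertex is its own neighbour, so the neighbourhood is a proper subset of the vertex
  set. The strict bound leaves room for the extra edge that each old vertex gains when a dominating
  vertex is added.\<close>

lemma degree_less_card_verts:
  assumes "simple_graph H" "v \<in> verts H"
  shows "degree H v < card (verts H)"
proof -
  have "finite (verts H)"
    using assms(1) by (simp add: simple_graph_def)
  moreover have "{x. {v, x} \<in> edges H} \<subset> verts H"
    using simple_graph_edgeD[OF assms(1)] assms(2) by blast
  ultimately show ?thesis
    unfolding degree_eq_card_neighbours[OF assms(1)] by (rule psubset_card_mono)
qed

text \<open>Removing \<open>v\<close> from a triangle through \<open>v\<close> leaves an edge inside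
  the neighbourhood of \<open>v\<close>, and inserting \<open>v\<close> reverses this. All later
  counts use this form: it speaks of edges only, so changes of the edge set can be followed
  directly.\<close>

lemma tri_degree_eq_card_edges:
  assumes "simple_graph H"
  shows "tri_degree H v = card {e \<in> edges H. v \<notin> e \<and> (\<forall>x\<in>e. {v, x} \<in> edges H)}"
    (is "_ = card ?L")
proof -
  have "{T \<in> triangles H. v \<in> T} = insert v ` ?L"
  proof (intro equalityI subsetI)
    fix T assume "T \<in> {T \<in> triangles H. v \<in> T}"
    then have T: "card T = 3" "v \<in> T"
      and E: "\<And>x y. x \<in> T \<Longrightarrow> y \<in> T \<Longrightarrow> x \<noteq> y \<Longrightarrow> {x, y} \<in> edges H"
      by (auto simp: triangles_def)
    then have "card (T - {v}) = 2"
      by simp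
    then obtain x y where xy: "T - {v} = {x, y}" "x \<noteq> y"
      by (auto simp: card_2_iff)
    then have "x \<in> T" "y \<in> T" "x \<noteq> v" "y \<noteq> v"
      by auto
    with xy E T have "T - {v} \<in> ?L"
      by auto
    then show "T \<in> insert v ` ?L"
      using T(2) by (intro image_eqI[of _ _ "T - {v}"]) auto
  next
    fix T assume "T \<in> insert v ` ?L"
    then obtain e where e: "e \<in> edges H" "v \<notin> e" "\<forall>x\<in>e. {v, x} \<in> edges H" "T = insert v e"
      by auto
    then obtain x y where "e = {x, y}" "x \<noteq> y" "x \<in> verts H" "y \<in> verts H"
      using simple_graph_edgeE[OF assms] by metis
    \<comment> \<open>Since \<open>v\<close> is not assumed to be a vertex, its membership in
      \<open>verts H\<close> is read off from the edge joining it to \<open>x\<close>.\<close>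
    with e simple_graph_edgeD[OF assms, of v x] show "T \<in> {T \<in> triangles H. v \<in> T}"
      by (auto simp: triangles_def insert_commute)
  qed
  moreover have "inj_on (insert v) ?L"
    by (rule inj_onI) (auto simp: insert_ident)
  ultimately show ?thesis
    by (simp add: tri_degree_def card_image)
qed

section \<open>Invariance under the relabelling by \<open>Suc\<close>\<close>

lemma degree_relabel: "degree (relabel H) (Suc v) = degree H v"
proof -
  have "{e \<in> edges (relabel H). Suc v \<in> e} = (`) Suc ` {e \<in> edges H. v \<in> e}"
    by (auto simp: relabel_def)
  then show ?thesis
    by (simp add: degree_def card_image inj_on_image inj_image_eq_iff inj_on_def)
qed

lemma simple_graph_relabel:
  assumes "simple_graph H"
  shows "simple_graph (relabel H)"
  using assms by (fastforce simp: simple_graph_def relabel_def card_image)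

lemma Suc_edge_relabel: "{Suc x, Suc y} \<in> edges (relabel H) \<longleftrightarrow> {x, y} \<in> edges H"
proof -
  have "{Suc x, Suc y} \<in> edges (relabel H) \<longleftrightarrow> Suc ` {x, y} \<in> (`) Suc ` edges H"
    by (simp add: relabel_def)
  also have "\<dots> \<longleftrightarrow> {x, y} \<in> edges H"
    by (rule inj_image_mem_iff) (simp add: inj_on_def inj_image_eq_iff)
  finally show ?thesis .
qed

lemma tri_degree_relabel:
  assumes "simple_graph H"
  shows "tri_degree (relabel H) (Suc v) = tri_degree H v"
proof -
  have "{e \<in> edges (relabel H). Suc v \<notin> e \<and> (\<forall>x\<in>e. {Suc v, x} \<in> edges (relabel H))}
    = (`) Suc ` {e \<in> edges H. v \<notin> e \<and> (\<forall>x\<in>e. {v, x} \<in> edges H)}" (is "?L = ?R")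
  proof -
    have "edges (relabel H) = (`) Suc ` edges H"
      by (simp add: relabel_def)
    \<comment> \<open>The outer edge set becomes an image, while the inner adjacency stays folded so
      that \<open>Suc_edge_relabel\<close> applies to it.\<close>
    then have "?L = {e \<in> (`) Suc ` edges H. Suc v \<notin> e \<and> (\<forall>x\<in>e. {Suc v, x} \<in> edges (relabel H))}"
      by simp
    also have "\<dots> = ?R"
      by (auto simp: Suc_edge_relabel)
    finally show ?thesis .
  qed
  then show ?thesis
    by (simp add: tri_degree_eq_card_edges assms simple_graph_relabel card_image inj_on_def
        inj_image_eq_iff)
qed

lemma card_edges_relabel: "card (edges (relabel H)) = card (edges H)"
  by (simp add: relabel_def card_image inj_on_def inj_image_eq_iff)


section \<open>Pendant and dominating vertices\<close>

context
  fixes H :: "'a graph" and w :: 'a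
  assumes simple: "simple_graph H" and w: "w \<notin> verts H"
begin

lemma not_in_edge: "e \<in> edges H \<Longrightarrow> w \<notin> e"
  using simple w by (auto simp: simple_graph_def)

section \<open>Adding a pendant vertex \<open>w\<close> at \<open>u\<close>\<close>

context
  fixes u and P :: "'a graph"
  assumes u: "u \<in> verts H"
  defines "P \<equiv> Graph (insert w (verts H)) (insert {u, w} (edges H))"
begin

lemma simple_pendant: "simple_graph P"
  using simple w u by (auto simp: simple_graph_def P_def card_insert_if)

lemma card_edges_pendant: "card (edges P) = Suc (card (edges H))"
proof -
  have "{u, w} \<notin> edges H"
    using not_in_edge by blast
  then show ?thesis
    using simple_graph_finite_edges[OF simple] by (simp add: P_def)
qed

lemma degree_pendant:
  assumes "v \<in> verts H"
  shows "degree P v = (if v = u then Suc (degree H v) else degree H v)"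
proof -
  have "{u, w} \<notin> {e \<in> edges H. v \<in> e}" "finite {e \<in> edges H. v \<in> e}"
    using simple_graph_finite_edges[OF simple] not_in_edge[of "{u, w}"] by auto
  then have "card (insert {u, w} {e \<in> edges H. v \<in> e}) = Suc (degree H v)"
    unfolding degree_def by (rule card_insert_disjoint[rotated])
  moreover have "{e \<in> edges P. v \<in> e}
      = (if v = u then insert {u, w} {e \<in> edges H. v \<in> e} else {e \<in> edges H. v \<in> e})"
    using assms w by (auto simp: P_def)
  ultimately show ?thesis
    by (simp only: degree_def split: if_split) simp
qed

lemma degree_pendant_new: "degree P w = 1"
proof -
  have "{e \<in> edges P. w \<in> e} = {{u, w}}"
    using not_in_edge by (auto simp: P_def)
  then show ?thesis
    by (simp add: degree_def)
qed

text \<open>An edge counted at \<open>v\<close> cannot contain \<open>w\<close>: then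
  \<open>w\<close> would be adjacent to \<open>v\<close>, forcing \<open>v = u\<close>, but the only
  edge at \<open>w\<close> is \<open>{u, w}\<close>, which contains \<open>u\<close>.\<close>

lemma tri_degree_pendant:
  assumes "v \<in> verts H"
  shows "tri_degree P v = tri_degree H v"
proof -
  have "{e \<in> edges P. v \<notin> e \<and> (\<forall>x\<in>e. {v, x} \<in> edges P)}
      = {e \<in> edges H. v \<notin> e \<and> (\<forall>x\<in>e. {v, x} \<in> edges H)}"
    using assms w not_in_edge by (auto simp: P_def doubleton_eq_iff)
  then show ?thesis
    by (simp add: tri_degree_eq_card_edges simple simple_pendant)
qed

lemma tri_degree_pendant_new: "tri_degree P w = 0"
proof -
  \<comment> \<open>The only neighbour of \<open>w\<close> is \<open>u\<close>, so both endpoints of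
    such an edge would equal \<open>u\<close>.\<close>
  have "False" if "e \<in> edges P" "w \<notin> e" "\<forall>x\<in>e. {w, x} \<in> edges P" for e
  proof -
    have "\<forall>x\<in>e. x = u"
      using that(3) not_in_edge by (auto simp: P_def doubleton_eq_iff)
    with that(1) show False
      by (auto elim!: simple_graph_edgeE[OF simple_pendant])
  qed
  then have "{e \<in> edges P. w \<notin> e \<and> (\<forall>x\<in>e. {w, x} \<in> edges P)} = {}"
    by auto
  then show ?thesis
    unfolding tri_degree_eq_card_edges[OF simple_pendant] by (simp only: card.empty)
qed

end

section \<open>The cone over \<open>H\<close> with apex \<open>w\<close>\<close>

context
  fixes C :: "'a graph"
  defines "C \<equiv> Graph (insert w (verts H)) (edges H \<union> (\<lambda>x. {w, x}) ` verts H)"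
begin

lemma inj_spoke: "inj_on (\<lambda>x. {w, x}) A"
  by (auto simp: inj_on_def doubleton_eq_iff)

lemma simple_cone: "simple_graph C"
  using simple w by (fastforce simp: simple_graph_def C_def card_insert_if)

lemma card_edges_cone: "card (edges C) = card (edges H) + card (verts H)"
proof -
  have "edges H \<inter> (\<lambda>x. {w, x}) ` verts H = {}"
    using not_in_edge by auto
  moreover have "finite (verts H)"
    using simple by (simp add: simple_graph_def)
  ultimately show ?thesis
    by (simp add: C_def card_Un_disjoint simple_graph_finite_edges[OF simple] card_image inj_spoke)
qed

lemma degree_cone:
  assumes "v \<in> verts H"
  shows "degree C v = Suc (degree H v)"
proof -
  have "{e \<in> edges C. v \<in> e} = insert {w, v} {e \<in> edges H. v \<in> e}"
    using assms w by (auto simp: C_def)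
  moreover have "{w, v} \<notin> {e \<in> edges H. v \<in> e}" "finite {e \<in> edges H. v \<in> e}"
    using simple_graph_finite_edges[OF simple] not_in_edge[of "{w, v}"] by auto
  ultimately show ?thesis
    by (simp add: degree_def)
qed

lemma degree_cone_apex: "degree C w = card (verts H)"
proof -
  have "{e \<in> edges C. w \<in> e} = (\<lambda>x. {w, x}) ` verts H"
    using not_in_edge by (auto simp: C_def)
  then show ?thesis
    by (simp add: degree_def card_image inj_spoke)
qed

text \<open>Besides its old triangles, \<open>v\<close> gains exactly one triangle
  \<open>{v, w, x}\<close> for each neighbour \<open>x\<close> in \<open>H\<close>. In the edge form
  these are the spokes \<open>{w, x}\<close> with \<open>x\<close> in \<open>?N\<close>.\<close>

lemma tri_degree_cone:
  assumes "v \<in> verts H"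
  shows "tri_degree C v = tri_degree H v + degree H v"
proof -
  let ?A = "{e \<in> edges H. v \<notin> e \<and> (\<forall>x\<in>e. {v, x} \<in> edges H)}"
  let ?N = "{x. {v, x} \<in> edges H}"
  have edge_old: "{v, x} \<in> edges C \<longleftrightarrow> {v, x} \<in> edges H" if "x \<noteq> w" for x
    using that assms w by (auto simp: C_def doubleton_eq_iff)
  have edge_apex: "{v, w} \<in> edges C"
    using assms by (auto simp: C_def)
  have "{e \<in> edges C. v \<notin> e \<and> (\<forall>x\<in>e. {v, x} \<in> edges C)} = ?A \<union> (\<lambda>x. {w, x}) ` ?N"
  proof (intro equalityI subsetI)
    fix e assume e: "e \<in> {e \<in> edges C. v \<notin> e \<and> (\<forall>x\<in>e. {v, x} \<in> edges C)}"
    then consider "e \<in> edges H" | x where "x \<in> verts H" "e = {w, x}"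
      by (auto simp: C_def)
    then show "e \<in> ?A \<union> (\<lambda>x. {w, x}) ` ?N"
    proof cases
      case 1
      then have "\<forall>x\<in>e. x \<noteq> w"
        using not_in_edge by auto
      with 1 e edge_old show ?thesis by auto
    next
      case 2
      with e edge_old[of x] w show ?thesis by auto
    qed
  next
    fix e assume "e \<in> ?A \<union> (\<lambda>x. {w, x}) ` ?N"
    then show "e \<in> {e \<in> edges C. v \<notin> e \<and> (\<forall>x\<in>e. {v, x} \<in> edges C)}"
    proof
      assume "e \<in> ?A"
      then show ?thesis by (auto simp: C_def)
    next
      assume "e \<in> (\<lambda>x. {w, x}) ` ?N"
      then obtain x where x: "e = {w, x}" "{v, x} \<in> edges H" by auto
      with simple_graph_edgeD[OF simple x(2)] assms w edge_apex show ?thesis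
        by (auto simp: C_def)
    qed
  qed
  moreover have "?A \<inter> (\<lambda>x. {w, x}) ` ?N = {}"
    using not_in_edge by auto
  moreover have "finite ?A"
    using simple_graph_finite_edges[OF simple] by simp
  moreover have "finite ?N"
    using simple simple_graph_edgeD[OF simple]
    by (auto simp: simple_graph_def intro: finite_subset[of _ "verts H"])
  ultimately show ?thesis
    by (simp add: tri_degree_eq_card_edges[OF simple_cone] tri_degree_eq_card_edges[OF simple]
        degree_eq_card_neighbours[OF simple] card_Un_disjoint card_image inj_spoke)
qed

text \<open>Every old vertex is adjacent to the apex, so each edge of \<open>H\<close> closes a
  triangle with it.\<close>

lemma tri_degree_cone_apex: "tri_degree C w = card (edges H)"
proof -
  have "{e \<in> edges C. w \<notin> e \<and> (\<forall>x\<in>e. {w, x} \<in> edges C)} = edges H"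
    using not_in_edge simple by (auto simp: C_def simple_graph_def)
  then show ?thesis
    by (simp add: tri_degree_eq_card_edges simple_cone)
qed

end

end

text \<open>This recognises the dominating step as the cone over the relabelled graph with apex 1,
  which makes the cone counts available for it.\<close>

lemma add_dominating_eq_cone:
  assumes "verts H = {1..n}"
  shows "add_dominating n H =
    Graph (insert 1 (verts (relabel H)))
      (edges (relabel H) \<union> (\<lambda>x. {1, x}) ` verts (relabel H))"
proof -
  have "verts (relabel H) = {2..n + 1}"
    using assms by (simp add: relabel_def numeral_2_eq_2)
  moreover have "{{1, i} | i. 2 \<le> i \<and> i \<le> n + 1} = (\<lambda>x. {1, x}) ` {2..n + 1}"
    unfolding image_def atLeastAtMost_iff Bex_def by blast
  ultimately show ?thesis
    unfolding add_dominating_def by (simp only:)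
qed

context
  fixes H :: "nat graph" and n :: nat
  assumes simple: "simple_graph H" and verts: "verts H = {1..n}"
begin

lemma one_notin_verts_relabel: "1 \<notin> verts (relabel H)"
  by (auto simp: relabel_def verts)

text \<open>These are the assumptions of the cone context for \<open>relabel H\<close>; the shift by
  \<open>Suc\<close> has freed the label 1 for the apex.\<close>

lemmas cone_relabel_facts = simple_graph_relabel[OF simple] one_notin_verts_relabel

lemma card_verts_relabel: "card (verts (relabel H)) = n"
  by (simp add: relabel_def verts card_image)

lemma Suc_in_verts_relabel: "i \<in> {1..n} \<Longrightarrow> Suc i \<in> verts (relabel H)"
  by (simp add: relabel_def verts)

lemma card_edges_add_dominating: "card (edges (add_dominating n H)) = card (edges H) + n"
  using card_edges_cone[OF cone_relabel_facts]
  by (simp add: add_dominating_eq_cone verts card_edges_relabel card_verts_relabel)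

lemma degree_add_dominating:
  assumes "i \<in> {1..n}"
  shows "degree (add_dominating n H) (Suc i) = Suc (degree H i)"
  using degree_cone[OF cone_relabel_facts Suc_in_verts_relabel[OF assms]]
  by (simp add: add_dominating_eq_cone verts degree_relabel)

lemma degree_add_dominating_1: "degree (add_dominating n H) 1 = n"
  using degree_cone_apex[OF cone_relabel_facts]
  by (simp add: add_dominating_eq_cone verts card_verts_relabel)

lemma tri_degree_add_dominating:
  assumes "i \<in> {1..n}"
  shows "tri_degree (add_dominating n H) (Suc i) = tri_degree H i + degree H i"
  using tri_degree_cone[OF cone_relabel_facts Suc_in_verts_relabel[OF assms]]
  by (simp add: add_dominating_eq_cone verts degree_relabel tri_degree_relabel simple)

lemma tri_degree_add_dominating_1: "tri_degree (add_dominating n H) 1 = card (edges H)"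
  using tri_degree_cone_apex[OF cone_relabel_facts]
  by (simp add: add_dominating_eq_cone verts card_edges_relabel)

end


section \<open>The invariant\<close>

text \<open>This and its weak counterpart reduce monotonicity to neighbouring labels, the form in
  which both construction steps compare vertices.\<close>

lemma strict_antimono_on_atLeastAtMostI:
  fixes f :: "nat \<Rightarrow> nat"
  assumes "\<And>i. a \<le> i \<Longrightarrow> i < b \<Longrightarrow> f (Suc i) < f i"
  shows "strict_antimono_on {a..b} f"
proof (rule monotone_onI)
  fix x y assume "x \<in> {a..b}" "y \<in> {a..b}" "x < y"
  then have "x < y" "a \<le> x" "y \<le> b" by auto
  then show "f y < f x"
  proof (induction rule: strict_inc_induct)
    case (base i) then show ?case using assms[of i] by auto
  next
    case (step i) then show ?case using assms[of i] by auto
  qed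
qed

lemma antimono_on_atLeastAtMostI:
  fixes f :: "nat \<Rightarrow> nat"
  assumes "\<And>i. a \<le> i \<Longrightarrow> i < b \<Longrightarrow> f (Suc i) \<le> f i"
  shows "antimono_on {a..b} f"
proof (rule monotone_onI)
  fix x y assume "x \<in> {a..b}" "y \<in> {a..b}" "x \<le> y"
  then have "x \<le> y" "a \<le> x" "y \<le> b" by auto
  then show "f y \<le> f x"
  proof (induction rule: inc_induct)
    case (step i) then show ?case using assms[of i] by auto
  qed simp
qed

definition ordered :: "nat \<Rightarrow> nat graph \<Rightarrow> bool" where
  "ordered n H \<longleftrightarrow> simple_graph H \<and> verts H = {1..n} \<and>
    strict_antimono_on {1..n} (tri_degree H) \<and> antimono_on {1..n} (degree H)"

text \<open>Positivity at \<open>n\<close> allows a vertex of triangle-degree 0 and degree 1 to be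
  appended last. Non-regularity keeps the pendant edge away from vertex 1, and the edge identity
  then turns into a strict inequality.\<close>

definition odd_inv :: "nat \<Rightarrow> nat graph \<Rightarrow> bool" where
  "odd_inv n H \<longleftrightarrow> ordered n H \<and> tri_degree H n > 0 \<and> degree H n > 0 \<and>
    card (edges H) = tri_degree H 1 + degree H 1 \<and> \<not> regular H"

text \<open>The first bound makes the next dominating vertex the one of largest triangle-degree.\<close>

definition even_inv :: "nat \<Rightarrow> nat graph \<Rightarrow> bool" where
  "even_inv n H \<longleftrightarrow> ordered n H \<and> tri_degree H 1 + degree H 1 < card (edges H) \<and>
    degree H n = 1"

lemma odd_inv_G7: "odd_inv 7 G7"
proof -
  have V: "{1..7::nat} = {1,2,3,4,5,6,7}"
    by auto
  have d: "degree G7 1 = 6" "degree G7 2 = 5" "degree G7 3 = 5" "degree G7 4 = 4"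
    "degree G7 5 = 4" "degree G7 6 = 3" "degree G7 7 = 3"
    unfolding degree_def G7_def by code_simp+
  have t: "tri_degree G7 1 = 9" "tri_degree G7 2 = 7" "tri_degree G7 3 = 6" "tri_degree G7 4 = 5"
    "tri_degree G7 5 = 4" "tri_degree G7 6 = 3" "tri_degree G7 7 = 2"
    \<comment> \<open>The edge form filters an explicit finite set and can be evaluated;
      \<open>triangles\<close> is a comprehension over arbitrary vertex sets.\<close>
    unfolding tri_degree_eq_card_edges[OF conjunct1[OF G7_simple]]
    unfolding G7_def by code_simp+
  have e: "card (edges G7) = 15"
    unfolding G7_def by code_simp
  have "ordered 7 G7"
    \<comment> \<open>Keeping the literal 1 from becoming \<open>Suc 0\<close> lets the computed
      values in \<open>d\<close> and \<open>t\<close> match.\<close>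
    unfolding ordered_def using G7_simple by (simp add: V monotone_on_def d t del: One_nat_def)
  moreover have "\<not> regular G7"
  proof
    assume "regular G7"
    then have "degree G7 1 = degree G7 7"
      using G7_simple by (auto simp: regular_def)
    then show False using d by simp
  qed
  ultimately show ?thesis
    unfolding odd_inv_def using d t e by simp
qed

lemma even_inv_add_pendant:
  assumes "odd_inv n H" "2 \<le> n"
  shows "even_inv (Suc n) (add_pendant n H)"
proof -
  let ?P = "add_pendant n H" and ?k = "first_min_degree n H"
  from assms have s: "simple_graph H" and V: "verts H = {1..n}"
    and tmono: "strict_antimono_on {1..n} (tri_degree H)"
    and dmono: "antimono_on {1..n} (degree H)"
    and pos: "tri_degree H n > 0" "degree H n > 0"
    and e: "card (edges H) = tri_degree H 1 + degree H 1" and nreg: "\<not> regular H"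
    by (auto simp: odd_inv_def ordered_def)
  have k: "?k \<in> {1..n}" "degree H ?k = min_degree H"
    using first_min_degree[OF V] assms(2) by auto
  have min_le: "min_degree H \<le> degree H i" if "i \<in> {1..n}" for i
    unfolding min_degree_def V using that by (intro Min_le) auto
  \<comment> \<open>As \<open>?k\<close> is the first index attaining the minimum, every earlier
    degree exceeds it by at least one; raising the degree of \<open>?k\<close> by one therefore
    preserves the order.\<close>
  have before: "min_degree H < degree H i" if "1 \<le> i" "i < ?k" for i
    using not_less_Least[OF that(2)[unfolded first_min_degree_def]] min_le[of i] that k(1)
    by force
  \<comment> \<open>The degrees decrease weakly from index 1, so a minimum attained there would make
    all degrees equal.\<close>
  have k1: "?k \<noteq> 1"
  proof
    assume "?k = 1"
    then have "degree H i = min_degree H" if "i \<in> {1..n}" for i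
      using monotone_onD[OF dmono, of 1 i] min_le[OF that] k(2) that by auto
    with nreg show False by (auto simp: regular_def V)
  qed
  have fresh: "n + 1 \<notin> verts H" and kV: "?k \<in> verts H"
    using V k by auto
  note P = add_pendant_def[of n H]
  have d: "degree ?P i = (if i = ?k then Suc (degree H i) else degree H i)" if "i \<in> {1..n}" for i
    using degree_pendant[OF s fresh kV] that by (simp add: P V)
  have dn: "degree ?P (Suc n) = 1"
    using degree_pendant_new[OF s fresh kV] by (simp add: P)
  have t: "tri_degree ?P i = tri_degree H i" if "i \<in> {1..n}" for i
    using tri_degree_pendant[OF s fresh kV] that by (simp add: P V)
  have tn: "tri_degree ?P (Suc n) = 0"
    using tri_degree_pendant_new[OF s fresh kV] by (simp add: P)
  have "strict_antimono_on {1..Suc n} (tri_degree ?P)"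
  proof (rule strict_antimono_on_atLeastAtMostI)
    fix i assume "1 \<le> i" "i < Suc n"
    then show "tri_degree ?P (Suc i) < tri_degree ?P i"
      using monotone_onD[OF tmono, of i "Suc i"] pos(1) by (cases "i = n") (auto simp: t tn)
  qed
  moreover have "antimono_on {1..Suc n} (degree ?P)"
  proof (rule antimono_on_atLeastAtMostI)
    fix i assume i: "1 \<le> i" "i < Suc n"
    show "degree ?P (Suc i) \<le> degree ?P i"
    proof (cases "i = n")
      \<comment> \<open>The degree of \<open>n\<close> has not dropped, so it is still at least 1,
        the degree of the new vertex.\<close>
      case True
      then show ?thesis using pos(2) i by (simp add: d dn)
    next
      case False
      then show ?thesis
        using monotone_onD[OF dmono, of i "Suc i"] before[of i] k(2) i by (auto simp: d)
    qed
  qed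
  moreover have "tri_degree ?P 1 + degree ?P 1 < card (edges ?P)"
    using card_edges_pendant[OF s fresh kV, folded P] e k1 assms(2) by (simp add: d t)
  ultimately show ?thesis
    using add_pendant_simple[OF s V] assms(2) dn by (simp add: even_inv_def ordered_def)
qed

text \<open>Among old vertices the new triangle-degrees are sums of a strictly and a weakly
  decreasing sequence, and all degrees rise by one. The edge identity is automatic: the apex has
  triangle-degree \<open>card (edges H)\<close> and degree \<open>n\<close>, and the new graph has
  \<open>card (edges H) + n\<close> edges.\<close>

lemma odd_inv_add_dominating:
  assumes "even_inv n H" "3 \<le> n"
  shows "odd_inv (Suc n) (add_dominating n H)"
proof -
  let ?C = "add_dominating n H"
  from assms have s: "simple_graph H" and V: "verts H = {1..n}"
    and tmono: "strict_antimono_on {1..n} (tri_degree H)"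
    and dmono: "antimono_on {1..n} (degree H)"
    and e: "tri_degree H 1 + degree H 1 < card (edges H)" and dn: "degree H n = 1"
    by (auto simp: even_inv_def ordered_def)
  note d = degree_add_dominating[OF s V] and d1 = degree_add_dominating_1[OF s V]
    and t = tri_degree_add_dominating[OF s V] and t1 = tri_degree_add_dominating_1[OF s V]
  have C: "simple_graph ?C" "verts ?C = {1..Suc n}"
    using add_dominating_simple[OF s V] by auto
  have "strict_antimono_on {1..Suc n} (tri_degree ?C)"
  proof (rule strict_antimono_on_atLeastAtMostI)
    fix i assume i: "1 \<le> i" "i < Suc n"
    show "tri_degree ?C (Suc i) < tri_degree ?C i"
    proof (cases "i = 1")
      case True
      then show ?thesis using t[of 1] t1 e assms(2) by simp
    next
      case False
      then obtain j where j: "i = Suc j" "1 \<le> j" "j < n"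
        using i by (cases i) auto
      then show ?thesis
        using monotone_onD[OF tmono, of j "Suc j"] monotone_onD[OF dmono, of j "Suc j"]
        by (simp add: t)
    qed
  qed
  moreover have "antimono_on {1..Suc n} (degree ?C)"
  proof (rule antimono_on_atLeastAtMostI)
    fix i assume i: "1 \<le> i" "i < Suc n"
    show "degree ?C (Suc i) \<le> degree ?C i"
    proof (cases "i = 1")
      case True
      \<comment> \<open>Vertex 1 of \<open>H\<close> has degree below \<open>n\<close>, hence at
        most \<open>n\<close> after gaining one edge, and \<open>n\<close> is the degree of the
        apex.\<close>
      then show ?thesis
        using degree_less_card_verts[OF s, of 1] V d[of 1] d1 assms(2) by simp
    next
      case False
      then obtain j where j: "i = Suc j" "1 \<le> j" "j < n"
        using i by (cases i) auto
      then show ?thesis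
        using monotone_onD[OF dmono, of j "Suc j"] by (simp add: d)
    qed
  qed
  \<comment> \<open>The former pendant vertex now has degree 2, while the apex has degree
    \<open>n\<close>, at least 3.\<close>
  moreover have "\<not> regular ?C"
  proof
    assume "regular ?C"
    then have "degree ?C 1 = degree ?C (Suc n)"
      by (auto simp: regular_def C)
    then show False
      using d1 d[of n] dn assms(2) by simp
  qed
  ultimately show ?thesis
    using C t[of n] d[of n] dn t1 d1 card_edges_add_dominating[OF s V] assms(2)
    by (simp add: odd_inv_def ordered_def)
qed

text \<open>The two steps alternate with the parity of \<open>n\<close>, each turning one invariant
  into the other; starting at 7 supplies their lower bounds on \<open>n\<close>.\<close>

lemma Gseq_inv:
  assumes "7 \<le> n"
  shows "if odd n then odd_inv n (Gseq n) else even_inv n (Gseq n)"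
  using assms
proof (induction n rule: dec_induct)
  case base
  \<comment> \<open>The guard \<open>n < 7\<close> in the recursion tests the predecessor, here 6,
    so the value at 7 is still \<open>G7\<close>.\<close>
  have "Gseq 7 = G7" by (simp add: eval_nat_numeral)
  then show ?case using odd_inv_G7 by simp
next
  case (step n)
  then show ?case
    using even_inv_add_pendant[of n "Gseq n"] odd_inv_add_dominating[of n "Gseq n"]
    by (auto split: if_splits)
qed

theorem theorem3:
  fixes n :: nat
  assumes "7 \<le> n"
  shows "triangle_distinct (Gseq n)
    \<and> strict_antimono_on {1..n} (tri_degree (Gseq n))
    \<and> antimono_on {1..n} (degree (Gseq n))
    \<and> (odd n \<longrightarrow>
         tri_degree (Gseq n) n > 0
         \<and> degree (Gseq n) n > 0
         \<and> card (edges (Gseq n)) = tri_degree (Gseq n) 1 + degree (Gseq n) 1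
         \<and> \<not> regular (Gseq n))"
proof -
  have ord: "ordered n (Gseq n)"
    using Gseq_inv[OF assms] by (auto simp: odd_inv_def even_inv_def split: if_splits)
  then have tmono: "strict_antimono_on {1..n} (tri_degree (Gseq n))"
    by (simp add: ordered_def)
  \<comment> \<open>Strict decrease makes the triangle-degrees pairwise distinct, as
    \<open>triangle_distinct\<close> demands.\<close>
  have "inj_on (tri_degree (Gseq n)) {1..n}"
  proof (rule linorder_inj_onI)
    fix x y assume "x < y" "x \<in> {1..n}" "y \<in> {1..n}"
    with monotone_onD[OF tmono, of x y] show "tri_degree (Gseq n) x \<noteq> tri_degree (Gseq n) y"
      by simp
  qed auto
  then show ?thesis
    using ord Gseq_inv[OF assms] assms by (auto simp: triangle_distinct_def ordered_def odd_inv_def)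
qed

end
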